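(* Let $I,O$ be disjoint finite sets of input and output propositional variables and let $A\notin I\cup O$ be a fresh propositional variable. Let $Rb^1(A)$ and $Rb^2(A)$ be robustness criteria, i.e. QDDC formulas over the variable $A$, such that $\models_{dc} Rb^1(A)\Rightarrow Rb^2(A)$. Then for all QDDC formulas $D_A,D_C$ over the variables $I\cup O$ we have: (a) $\mathrm{MPS}(D_A,D_C,Rb^1(A))\ \leq_{must}^{D_C}\ \mathrm{MPS}(D_A,D_C,Rb^2(A))$ (whenever both of these supervisors exist); (b) if the robust specification $(D_A,D_C,Rb^2(A))$ is realizable, then the robust specification $(D_A,D_C,Rb^1(A))$ is also realizable.
   Context: **QDDC.** Let $PV$ be a finite non-empty set of propositional variables and $\sigma=P_0\cdots P_n$ a non-empty finite word over $2^{PV}$, with $dom(\sigma)=\{0,\dots,n\}$, $\sigma[i]=P_i$. For a propositional formula $\varphi$ over $PV$, $\sigma,i\models\varphi$ means that $\varphi$ is true under the valuation making exactly the variables in $P_i$ true. QDDC formulas are $$D ::= \langle\varphi\rangle \mid [\varphi]\mid [[\varphi]] \mid D{}^\frown D\mid\ !D\mid D\,||\,D\mid D\,\&\&\,D\mid ex\ p.\,D\mid all\ p.\,D\mid slen\bowtie c\mid scount\ \varphi\bowtie c\mid sdur\ \varphi\bowtie c$$ with $\varphi$ propositional, $p\in PV$, $c\in\mathbb N$, $\bowtie\in\{<,\le,=,\ge,>\}$; $true$ and $false$ are the formulas holding on all, respectively no, intervals; $\Rightarrow,\Leftrightarrow,\land$ are the usual Boolean connectives. For an interval $[b,e]$ with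 $b\le e$ in $dom(\sigma)$: $\sigma,[b,e]\models\langle\varphi\rangle$ iff $b=e$ and $\sigma,b\models\varphi$; $\models[\varphi]$ iff $b<e$ and $\sigma,i\models\varphi$ for all $b\le i<e$; $\models[[\varphi]]$ iff $\sigma,i\models\varphi$ for all $b\le i\le e$; $\models D_1{}^\frown D_2$ iff there is $i$ with $b\le i\le e$, $\sigma,[b,i]\models D_1$ and $\sigma,[i,e]\models D_2$; Boolean connectives as usual; $\models ex\ p.\,D$ iff $\sigma',[b,e]\models D$ for some word $\sigma'$ of the same length as $\sigma$ agreeing with $\sigma$ at all positions on all variables other than $p$; $all\ p.\,D$ is $!(ex\ p.\,!D)$. The term $slen$ has value $e-b$, $scount\ \varphi$ is the number of $i\in[b,e]$ with $\sigma,i\models\varphi$, and $sdur\ \varphi$ is the number of $i$ with $b\le i<e$ and $\sigma,i\models\varphi$. Derived: $pref(D)=\ !((!D){}^\frown true)$ (so $D$ holds on all prefix intervals $[b,e']$, $b\le e'\le e$); $EP(w)=true{}^\frown\langle w\rangle$. Put $\sigma\models D$ iff $\sigma,[0,n]\models D$; $L(D)=\{\sigma\mid\sigma\models D\}$; $\models_{dc}D$ ($D$ is valid) iff $L(D)=(2^{PV})^+$. **Supervisors.** For disjoint finite sets $I$ (inputs) and $O$ (outputs), an output-nondeterministic Mealy machine over $(I,O)$ is a total DFA $(Q,2^I\times 2^O,s,\delta,F)$, $Q$ finite, $\delta:Q\times 2^I\times 2^O\to Q$, with a unique non-final state $r$ ($F=Q\setminus\{r\}$), which is a sink: $\delta(r,i,o)=r$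 for all $i,o$; the initial state $s$ is in $F$. It is non-blocking if for all $q\in F$, $i\in 2^I$ there is $o\in 2^O$ with $\delta(q,i,o)\in F$. A supervisor is a non-blocking output-nondeterministic Mealy machine. Its language $L(Sup)$ is the set of accepted non-empty words. Such words are identified both with words over $2^{I\cup O}$ and with pairs $(ii,oo)$ of equal-length words $ii\in(2^I)^+$, $oo\in(2^O)^+$. Determinism order: $Sup_1\leq_{det}Sup_2$ iff $L(Sup_2)\subseteq L(Sup_1)$. Must dominance: $MustInp(Sup,D)=\{ii\in(2^I)^+\mid\forall oo.\ ((ii,oo)\in L(Sup)\Rightarrow (ii,oo)\models D)\}$, and $Sup_1\leq_{must}^{D}Sup_2$ iff $MustInp(Sup_1,D)\subseteq MustInp(Sup_2,D)$. $Sup$ realizes $\mathbf{inv}\,D$ iff $L(Sup)\subseteq L(D)$. A supervisor $Sup$ realizing $\mathbf{inv}\,D$ is maximally permissive if $Sup\leq_{det}Sup'$ for every supervisor $Sup'$ realizing $\mathbf{inv}\,D$. It is unique up to language equivalence; the one with minimum number of states is denoted $\mathrm{MPS}(D)$. $\mathrm{MPS}(D)$ is said to be realizable if it exists. **Robust specifications.** A robust specification is a triple $(D_A,D_C,Rb(A))$ where $D_A$ (assumption) and $D_C$ (commitment) are QDDC formulas over $I\cup O$ and $Rb(A)$ (robustness criterion) is a QDDC formula over the fresh variable $A$. $\mathrm{MPS}(D_A,D_C,Rb(A))$ denotes $\mathrm{MPS}(\phi)$ for the formula $$\phi\;=\;\big(Rb(A)\land pref(EP(A)\Leftrightarrow D_A)\big)\Rightarrow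 D_C$$ with input variables $I$ and output variables $O\cup\{A\}$. The robust specification is realizable iff $\mathrm{MPS}(\phi)$ exists. *)

theory Defs
  imports Main
begin

section \<open>QDDC\<close>

datatype 'v pform =
    PTrue | PFalse | PVar 'v
  | PNot "'v pform" | PAnd "'v pform" "'v pform" | POr "'v pform" "'v pform"

primrec pholds :: "'v set \<Rightarrow> 'v pform \<Rightarrow> bool" where
  "pholds P PTrue \<longleftrightarrow> True"
| "pholds P PFalse \<longleftrightarrow> False"
| "pholds P (PVar x) \<longleftrightarrow> x \<in> P"
| "pholds P (PNot f) \<longleftrightarrow> \<not> pholds P f"
| "pholds P (PAnd f g) \<longleftrightarrow> pholds P f \<and> pholds P g"
| "pholds P (POr f g) \<longleftrightarrow> pholds P f \<or> pholds P g"

datatype cmp = CLess | CLeq | CEq | CGeq | CGreater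

primrec compare :: "cmp \<Rightarrow> nat \<Rightarrow> nat \<Rightarrow> bool" where
  "compare CLess m n \<longleftrightarrow> m < n"
| "compare CLeq m n \<longleftrightarrow> m \<le> n"
| "compare CEq m n \<longleftrightarrow> m = n"
| "compare CGeq m n \<longleftrightarrow> m \<ge> n"
| "compare CGreater m n \<longleftrightarrow> m > n"

text \<open>
  \<open>Point f\<close> is \<open>\<langle>f\<rangle>\<close>, \<open>Interval f\<close> is \<open>[f]\<close> (last position of the interval excluded,
  interval non-degenerate), and \<open>FullInterval f\<close> is \<open>[[f]]\<close> (last position included).
\<close>

datatype 'v qddc =
    Point "'v pform"
  | Interval "'v pform"
  | FullInterval "'v pform"
  | Chop "'v qddc" "'v qddc"
  | DNot "'v qddc"
  | DOr "'v qddc" "'v qddc"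
  | DAnd "'v qddc" "'v qddc"
  | DEx 'v "'v qddc"
  | DAll 'v "'v qddc"
  | Slen cmp nat
  | Scount "'v pform" cmp nat
  | Sdur "'v pform" cmp nat

text \<open>
  Words are lists of sets of variables. The relation below is meaningful for
  \<open>b \<le> e < length \<sigma>\<close>.
\<close>

definition agree_except :: "'v \<Rightarrow> 'v set list \<Rightarrow> 'v set list \<Rightarrow> bool" where
  "agree_except p \<sigma> \<sigma>' \<longleftrightarrow>
     length \<sigma>' = length \<sigma> \<and> (\<forall>i<length \<sigma>. \<forall>x. x \<noteq> p \<longrightarrow> (x \<in> \<sigma>' ! i \<longleftrightarrow> x \<in> \<sigma> ! i))"

primrec sat :: "'v set list \<Rightarrow> nat \<Rightarrow> nat \<Rightarrow> 'v qddc \<Rightarrow> bool" where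
  "sat \<sigma> b e (Point f) \<longleftrightarrow> b = e \<and> pholds (\<sigma> ! b) f"
| "sat \<sigma> b e (Interval f) \<longleftrightarrow> b < e \<and> (\<forall>i. b \<le> i \<and> i < e \<longrightarrow> pholds (\<sigma> ! i) f)"
| "sat \<sigma> b e (FullInterval f) \<longleftrightarrow> (\<forall>i. b \<le> i \<and> i \<le> e \<longrightarrow> pholds (\<sigma> ! i) f)"
| "sat \<sigma> b e (Chop C D) \<longleftrightarrow> (\<exists>i. b \<le> i \<and> i \<le> e \<and> sat \<sigma> b i C \<and> sat \<sigma> i e D)"
| "sat \<sigma> b e (DNot D) \<longleftrightarrow> \<not> sat \<sigma> b e D"
| "sat \<sigma> b e (DOr C D) \<longleftrightarrow> sat \<sigma> b e C \<or> sat \<sigma> b e D"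
| "sat \<sigma> b e (DAnd C D) \<longleftrightarrow> sat \<sigma> b e C \<and> sat \<sigma> b e D"
| "sat \<sigma> b e (DEx p D) \<longleftrightarrow> (\<exists>\<sigma>'. agree_except p \<sigma> \<sigma>' \<and> sat \<sigma>' b e D)"
| "sat \<sigma> b e (DAll p D) \<longleftrightarrow> \<not> (\<exists>\<sigma>'. agree_except p \<sigma> \<sigma>' \<and> \<not> sat \<sigma>' b e D)"
| "sat \<sigma> b e (Slen r c) \<longleftrightarrow> compare r (e - b) c"
| "sat \<sigma> b e (Scount f r c) \<longleftrightarrow> compare r (card {i. b \<le> i \<and> i \<le> e \<and> pholds (\<sigma> ! i) f}) c"
| "sat \<sigma> b e (Sdur f r c) \<longleftrightarrow> compare r (card {i. b \<le> i \<and> i < e \<and> pholds (\<sigma> ! i) f}) c"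

text \<open>
  \<open>D\<close> is a formula over \<open>PV\<close> iff \<open>qvars D \<subseteq> PV\<close>. Quantified variables are counted as well,
  since the grammar of formulas over \<open>PV\<close> only admits quantification over members of \<open>PV\<close>;
  hence the words \<open>\<sigma>'\<close> in the clauses for the quantifiers stay over \<open>PV\<close> when \<open>\<sigma>\<close> is over \<open>PV\<close>.
\<close>

primrec qvars :: "'v qddc \<Rightarrow> 'v set" where
  "qvars (Point f) = set_pform f"
| "qvars (Interval f) = set_pform f"
| "qvars (FullInterval f) = set_pform f"
| "qvars (Chop C D) = qvars C \<union> qvars D"
| "qvars (DNot D) = qvars D"
| "qvars (DOr C D) = qvars C \<union> qvars D"
| "qvars (DAnd C D) = qvars C \<union> qvars D"
| "qvars (DEx p D) = insert p (qvars D)"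
| "qvars (DAll p D) = insert p (qvars D)"
| "qvars (Slen r c) = {}"
| "qvars (Scount f r c) = set_pform f"
| "qvars (Sdur f r c) = set_pform f"

definition DTrue :: "'v qddc" where
  "DTrue = FullInterval PTrue"

definition DImp :: "'v qddc \<Rightarrow> 'v qddc \<Rightarrow> 'v qddc" where
  "DImp C D = DOr (DNot C) D"

definition DIff :: "'v qddc \<Rightarrow> 'v qddc \<Rightarrow> 'v qddc" where
  "DIff C D = DAnd (DImp C D) (DImp D C)"

definition pref :: "'v qddc \<Rightarrow> 'v qddc" where
  "pref D = DNot (Chop (DNot D) DTrue)"

definition EP :: "'v pform \<Rightarrow> 'v qddc" where
  "EP w = Chop DTrue (Point w)"

definition words :: "'v set \<Rightarrow> 'v set list set" where
  "words PV = {\<sigma>. \<sigma> \<noteq> [] \<and> (\<forall>P\<in>set \<sigma>. P \<subseteq> PV)}"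

definition models :: "'v set list \<Rightarrow> 'v qddc \<Rightarrow> bool" where
  "models \<sigma> D \<longleftrightarrow> sat \<sigma> 0 (length \<sigma> - 1) D"

definition lang :: "'v set \<Rightarrow> 'v qddc \<Rightarrow> 'v set list set" where
  "lang PV D = {\<sigma> \<in> words PV. models \<sigma> D}"

definition valid :: "'v set \<Rightarrow> 'v qddc \<Rightarrow> bool" where
  "valid PV D \<longleftrightarrow> lang PV D = words PV"


section \<open>Supervisors\<close>

record ('q, 'v) mealy =
  states :: "'q set"
  init :: 'q
  trans :: "'q \<Rightarrow> 'v set \<Rightarrow> 'v set \<Rightarrow> 'q"
  final :: "'q set"

definition mealy_machine :: "'v set \<Rightarrow> 'v set \<Rightarrow> ('q, 'v) mealy \<Rightarrow> bool" where
  "mealy_machine Inp Out M \<longleftrightarrow>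
     finite (states M) \<and>
     (\<forall>q\<in>states M. \<forall>i\<subseteq>Inp. \<forall>o'\<subseteq>Out. trans M q i o' \<in> states M) \<and>
     (\<exists>r\<in>states M. final M = states M - {r} \<and> (\<forall>i\<subseteq>Inp. \<forall>o'\<subseteq>Out. trans M r i o' = r)) \<and>
     init M \<in> final M"

definition non_blocking :: "'v set \<Rightarrow> 'v set \<Rightarrow> ('q, 'v) mealy \<Rightarrow> bool" where
  "non_blocking Inp Out M \<longleftrightarrow>
     (\<forall>q\<in>final M. \<forall>i\<subseteq>Inp. \<exists>o'\<subseteq>Out. trans M q i o' \<in> final M)"

definition supervisor :: "'v set \<Rightarrow> 'v set \<Rightarrow> ('q, 'v) mealy \<Rightarrow> bool" where
  "supervisor Inp Out M \<longleftrightarrow> mealy_machine Inp Out M \<and> non_blocking Inp Out M"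

text \<open>
  Machines read words over \<open>Inp \<union> Out\<close>; as \<open>Inp\<close> and \<open>Out\<close> are disjoint, a letter \<open>P\<close>
  corresponds to the pair \<open>(P \<inter> Inp, P \<inter> Out)\<close>.
\<close>

definition run :: "'v set \<Rightarrow> 'v set \<Rightarrow> ('q, 'v) mealy \<Rightarrow> 'v set list \<Rightarrow> 'q" where
  "run Inp Out M \<sigma> = foldl (\<lambda>q P. trans M q (P \<inter> Inp) (P \<inter> Out)) (init M) \<sigma>"

definition sup_lang :: "'v set \<Rightarrow> 'v set \<Rightarrow> ('q, 'v) mealy \<Rightarrow> 'v set list set" where
  "sup_lang Inp Out M = {\<sigma> \<in> words (Inp \<union> Out). run Inp Out M \<sigma> \<in> final M}"

definition det_le ::
  "'v set \<Rightarrow> 'v set \<Rightarrow> ('p, 'v) mealy \<Rightarrow> ('q, 'v) mealy \<Rightarrow> bool" where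
  "det_le Inp Out S1 S2 \<longleftrightarrow> sup_lang Inp Out S2 \<subseteq> sup_lang Inp Out S1"

definition join_words :: "'v set list \<Rightarrow> 'v set list \<Rightarrow> 'v set list" where
  "join_words ii oo = map2 (\<union>) ii oo"

definition MustInp ::
  "'v set \<Rightarrow> 'v set \<Rightarrow> ('q, 'v) mealy \<Rightarrow> 'v qddc \<Rightarrow> 'v set list set" where
  "MustInp Inp Out S D =
     {ii \<in> words Inp. \<forall>oo\<in>words Out. length oo = length ii \<longrightarrow>
        join_words ii oo \<in> sup_lang Inp Out S \<longrightarrow> models (join_words ii oo) D}"

definition must_le ::
  "'v set \<Rightarrow> 'v set \<Rightarrow> 'v qddc \<Rightarrow> ('p, 'v) mealy \<Rightarrow> ('q, 'v) mealy \<Rightarrow> bool" where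
  "must_le Inp Out D S1 S2 \<longleftrightarrow> MustInp Inp Out S1 D \<subseteq> MustInp Inp Out S2 D"

definition realizes_inv :: "'v set \<Rightarrow> 'v set \<Rightarrow> 'v qddc \<Rightarrow> ('q, 'v) mealy \<Rightarrow> bool" where
  "realizes_inv Inp Out D S \<longleftrightarrow> sup_lang Inp Out S \<subseteq> lang (Inp \<union> Out) D"

text \<open>
  State sets are finite, so quantifying over machines whose states are natural numbers
  covers all supervisors up to renaming of states.
\<close>

definition maximally_permissive ::
  "'v set \<Rightarrow> 'v set \<Rightarrow> 'v qddc \<Rightarrow> (nat, 'v) mealy \<Rightarrow> bool" where
  "maximally_permissive Inp Out D S \<longleftrightarrow>
     supervisor Inp Out S \<and> realizes_inv Inp Out D S \<and>
     (\<forall>S' :: (nat, 'v) mealy. supervisor Inp Out S' \<and> realizes_inv Inp Out D S' \<longrightarrow>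
        det_le Inp Out S S')"

text \<open>
  The machine \<open>MPS(D)\<close> is determined only up to isomorphism, so it is rendered as a predicate.
\<close>

definition is_MPS ::
  "'v set \<Rightarrow> 'v set \<Rightarrow> 'v qddc \<Rightarrow> (nat, 'v) mealy \<Rightarrow> bool" where
  "is_MPS Inp Out D S \<longleftrightarrow>
     maximally_permissive Inp Out D S \<and>
     (\<forall>S'. maximally_permissive Inp Out D S' \<longrightarrow> card (states S) \<le> card (states S'))"


section \<open>Robust specifications\<close>

definition robust_formula ::
  "'v \<Rightarrow> 'v qddc \<Rightarrow> 'v qddc \<Rightarrow> 'v qddc \<Rightarrow> 'v qddc" where
  "robust_formula A DA DC Rb =
     DImp (DAnd Rb (pref (DIff (EP (PVar A)) DA))) DC"

definition is_robust_MPS ::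
  "'v set \<Rightarrow> 'v set \<Rightarrow> 'v \<Rightarrow> 'v qddc \<Rightarrow> 'v qddc \<Rightarrow> 'v qddc \<Rightarrow> (nat, 'v) mealy \<Rightarrow> bool" where
  "is_robust_MPS Inp Out A DA DC Rb S \<longleftrightarrow>
     is_MPS Inp (insert A Out) (robust_formula A DA DC Rb) S"

definition robust_realizable ::
  "'v set \<Rightarrow> 'v set \<Rightarrow> 'v \<Rightarrow> 'v qddc \<Rightarrow> 'v qddc \<Rightarrow> 'v qddc \<Rightarrow> bool" where
  "robust_realizable Inp Out A DA DC Rb \<longleftrightarrow> (\<exists>S. is_robust_MPS Inp Out A DA DC Rb S)"

end

(*
  Since Rb1 implies Rb2, every supervisor for the specification with Rb2 is also one for the
  specification with Rb1. Part (a) is then the maximality of the first supervisor. For part (b)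
  it remains to see that a formula realized by some supervisor has a maximally permissive one.
  The language of a QDDC formula has finitely many residuals, so the safety game whose positions
  are these residuals is finite, and its winning region is the maximally permissive supervisor.
*)
theory Submission
  imports Defs
begin

section \<open>Languages with finitely many residuals\<close>

text \<open>Letters are arbitrary sets of variables, so finiteness cannot come from the alphabet: it
  comes from counters capped by the constants of the formula and from subset constructions for chop
  and the quantifiers. Residuals play the part of automaton states, so no product or determinization
  has to be encoded. The empty word is the delicate point: QDDC has a meaning only on non-empty
  words, while the game starts before any letter is read. Hence \<open>[]\<close> is kept out of the
  languages of formulas and joins the safety objective only when the game is set up.\<close>

definition residual :: "'a list set \<Rightarrow> 'a list \<Rightarrow> 'a list set" where
  "residual L u = {v. u @ v \<in> L}"

definition finite_residuals :: "'a list set \<Rightarrow> bool" where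
  "finite_residuals L \<longleftrightarrow> finite (range (residual L))"

lemma in_residual [simp]: "v \<in> residual L u \<longleftrightarrow> u @ v \<in> L"
  by (simp add: residual_def)

lemma finite_residualsI:
  assumes "finite R" and "\<And>u. residual L u \<in> R"
  shows "finite_residuals L"
  unfolding finite_residuals_def
  by (rule finite_subset[OF _ assms(1)]) (use assms(2) in blast)

text \<open>A Myhill-Nerode criterion: \<open>g\<close> is a summary of the word read so far that
  determines its residual, so one representative \<open>inv g y\<close> per value suffices. An
  implication is enough in the second assumption because \<open>u\<close> and \<open>u'\<close> can
  be swapped.\<close>

lemma finite_residuals_invariant:
  assumes "finite (range g)"
    and "\<And>u u' v. g u = g u' \<Longrightarrow> u @ v \<in> L \<Longrightarrow> u' @ v \<in> L"
  shows "finite_residuals L"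
proof (rule finite_residualsI)
  show "finite ((\<lambda>y. residual L (inv g y)) ` range g)"
    using assms(1) by (rule finite_imageI)
  fix u
  have "g (inv g (g u)) = g u"
    by (simp add: f_inv_into_f)
  then have "residual L (inv g (g u)) = residual L u"
    unfolding residual_def using assms(2)[of "inv g (g u)" u] assms(2)[of u "inv g (g u)"] by metis
  then show "residual L u \<in> (\<lambda>y. residual L (inv g y)) ` range g"
    by (metis imageI rangeI)
qed

lemma finite_residuals_Compl:
  assumes "finite_residuals L"
  shows "finite_residuals (- L)"
proof (rule finite_residualsI)
  show "finite (uminus ` range (residual L))"
    using assms unfolding finite_residuals_def by (rule finite_imageI)
  fix u
  have "residual (- L) u = - residual L u"
    by auto
  then show "residual (- L) u \<in> uminus ` range (residual L)"
    by simp
qed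

lemma finite_residuals_Un:
  assumes "finite_residuals L" and "finite_residuals K"
  shows "finite_residuals (L \<union> K)"
proof (rule finite_residualsI)
  show "finite ((\<lambda>(X, Y). X \<union> Y) ` (range (residual L) \<times> range (residual K)))"
    using assms unfolding finite_residuals_def by blast
  fix u
  have "residual (L \<union> K) u = (\<lambda>(X, Y). X \<union> Y) (residual L u, residual K u)"
    by auto
  then show "residual (L \<union> K) u \<in> (\<lambda>(X, Y). X \<union> Y) ` (range (residual L) \<times> range (residual K))"
    by (metis imageI SigmaI rangeI)
qed

lemma finite_residuals_Int:
  assumes "finite_residuals L" and "finite_residuals K"
  shows "finite_residuals (L \<inter> K)"
  using finite_residuals_Compl[OF finite_residuals_Un[OF assms[THEN finite_residuals_Compl]]]
  by simp

lemma finite_residuals_Nil: "finite_residuals {[]}"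
  by (rule finite_residuals_invariant[where g = "\<lambda>u. u = []"]) auto

text \<open>The language counterpart of chop: the letter at position \<open>i\<close> belongs to
  both factors, just as the two intervals of a chop share a point.\<close>

definition fusion :: "'a list set \<Rightarrow> 'a list set \<Rightarrow> 'a list set" where
  "fusion L K = {w. \<exists>i<length w. take (Suc i) w \<in> L \<and> drop i w \<in> K}"

text \<open>The shared letter lies either in \<open>u\<close>, and then only a residual of
  \<open>K\<close> remains to be read, or in the continuation, and then the left factor starts with
  all of \<open>u\<close>.\<close>

lemma residual_fusion:
  "residual (fusion L K) u =
     \<Union> ((\<lambda>i. residual K (drop i u)) ` {i. i < length u \<and> take (Suc i) u \<in> L}) \<union> fusion (residual L u) K"
proof (rule set_eqI)
  fix v
  have split: "(\<exists>i<length (u @ v). P i) \<longleftrightarrow> (\<exists>i<length u. P i) \<or> (\<exists>j<length v. P (length u + j))"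
    for P :: "nat \<Rightarrow> bool"
  proof (intro iffI)
    assume "\<exists>i<length (u @ v). P i"
    then obtain i where i: "i < length u + length v" "P i"
      by auto
    show "(\<exists>i<length u. P i) \<or> (\<exists>j<length v. P (length u + j))"
    proof (cases "i < length u")
      case False
      then have "i - length u < length v" "P (length u + (i - length u))"
        using i by auto
      then show ?thesis
        by blast
    qed (use i in blast)
  next
    assume "(\<exists>i<length u. P i) \<or> (\<exists>j<length v. P (length u + j))"
    then show "\<exists>i<length (u @ v). P i"
      by (metis length_append nat_add_left_cancel_less trans_less_add1)
  qed
  show "v \<in> residual (fusion L K) u \<longleftrightarrow>
      v \<in> \<Union> ((\<lambda>i. residual K (drop i u)) ` {i. i < length u \<and> take (Suc i) u \<in> L}) \<union> fusion (residual L u) K"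
    unfolding in_residual fusion_def mem_Collect_eq split by (auto simp: Suc_diff_le)
qed

text \<open>A subset construction: by \<open>residual_fusion\<close> a residual is determined by a
  set of residuals of \<open>K\<close>, one for each cut made so far, and a single residual of
  \<open>L\<close>.\<close>

lemma finite_residuals_fusion:
  assumes "finite_residuals L" and "finite_residuals K"
  shows "finite_residuals (fusion L K)"
proof (rule finite_residualsI)
  let ?F = "\<lambda>(S, R). \<Union> S \<union> fusion R K"
  let ?A = "Pow (range (residual K)) \<times> range (residual L)"
  show "finite (?F ` ?A)"
    using assms unfolding finite_residuals_def by blast
  fix u
  have "residual (fusion L K) u =
      ?F ((\<lambda>i. residual K (drop i u)) ` {i. i < length u \<and> take (Suc i) u \<in> L}, residual L u)"
    by (simp add: residual_fusion)
  then show "residual (fusion L K) u \<in> ?F ` ?A"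
    by (rule image_eqI) auto
qed

text \<open>The assumption \<open>append\<close> makes \<open>R\<close> act piecewise, so the guess
  for \<open>u\<close> and the guess for the rest are independent. After \<open>u\<close>, only the
  set of residuals of \<open>L\<close> at the possible guesses \<open>u'\<close> matters. This is
  the projection that interprets \<open>DEx\<close>.\<close>

lemma finite_residuals_relational_image:
  assumes append: "\<And>u v w. R (u @ v) w \<longleftrightarrow> (\<exists>u' v'. w = u' @ v' \<and> R u u' \<and> R v v')"
    and "finite_residuals L"
  shows "finite_residuals {w. \<exists>w'. R w w' \<and> w' \<in> L}"
proof (rule finite_residualsI)
  let ?F = "\<lambda>S. {v. \<exists>v'. R v v' \<and> v' \<in> \<Union> S}"
  show "finite (?F ` Pow (range (residual L)))"
    using assms(2) unfolding finite_residuals_def by blast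
  fix u
  have "residual {w. \<exists>w'. R w w' \<and> w' \<in> L} u = ?F (residual L ` {u'. R u u'})"
    unfolding residual_def by (auto simp: append)
  then show "residual {w. \<exists>w'. R w w' \<and> w' \<in> L} u \<in> ?F ` Pow (range (residual L))"
    by (rule image_eqI) auto
qed

section \<open>Locality of the QDDC semantics\<close>

lemma pholds_cong:
  assumes "P \<inter> V = Q \<inter> V" and "set_pform f \<subseteq> V"
  shows "pholds P f \<longleftrightarrow> pholds Q f"
  using assms(2) by (induction f) (use assms(1) in auto)

lemma card_shift:
  "card {i. b \<le> i \<and> i \<le> b + n \<and> P i} = card {j. j \<le> n \<and> P (b + j)}" for b n :: nat
proof -
  have "{i. b \<le> i \<and> i \<le> b + n \<and> P i} = (+) b ` {j. j \<le> n \<and> P (b + j)}"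
    by (auto simp: image_iff le_iff_add)
  then show ?thesis
    by (simp add: card_image)
qed

lemma card_shift_strict:
  "card {i. b \<le> i \<and> i < b + n \<and> P i} = card {j. j < n \<and> P (b + j)}" for b n :: nat
proof -
  have "{i. b \<le> i \<and> i < b + n \<and> P i} = (+) b ` {j. j < n \<and> P (b + j)}"
    by (auto simp: image_iff le_iff_add)
  then show ?thesis
    by (simp add: card_image)
qed

lemma all_shift: "(\<forall>i. b \<le> i \<and> i \<le> b + n \<longrightarrow> P i) \<longleftrightarrow> (\<forall>j\<le>n. P (b + j))" for b n :: nat
  by (metis add_le_cancel_left le_add1 le_iff_add)

lemma all_shift_strict: "(\<forall>i. b \<le> i \<and> i < b + n \<longrightarrow> P i) \<longleftrightarrow> (\<forall>j<n. P (b + j))" for b n :: nat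
  by (metis add_less_cancel_left le_add1 le_iff_add)

lemma ex_shift: "(\<exists>i. b \<le> i \<and> i \<le> b + n \<and> P i) \<longleftrightarrow> (\<exists>j\<le>n. P (b + j))" for b n :: nat
  by (metis add_le_cancel_left le_add1 le_iff_add)

lemma agree_except_transfer:
  assumes "agree_except p \<sigma> \<tau>" and "b + n < length \<sigma>" and "b' + n < length \<sigma>'"
    and "\<forall>j\<le>n. \<sigma> ! (b + j) \<inter> V = \<sigma>' ! (b' + j) \<inter> V"
  obtains \<tau>' where "agree_except p \<sigma>' \<tau>'"
    and "\<forall>j\<le>n. \<tau> ! (b + j) \<inter> V = \<tau>' ! (b' + j) \<inter> V"
proof
  \<comment> \<open>The witness keeps \<open>\<sigma>'\<close> and copies into the window at
    \<open>b'\<close> the values that \<open>\<tau>\<close> gives to \<open>p\<close> in the window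
    at \<open>b\<close>.\<close>
  let ?f = "\<lambda>k. if b' \<le> k \<and> k \<le> b' + n
      then \<sigma>' ! k - {p} \<union> \<tau> ! (b + (k - b')) \<inter> {p} else \<sigma>' ! k"
  let ?t = "map ?f [0..<length \<sigma>']"
  show "agree_except p \<sigma>' ?t"
    by (auto simp: agree_except_def)
  show "\<forall>j\<le>n. \<tau> ! (b + j) \<inter> V = ?t ! (b' + j) \<inter> V"
  proof (intro allI impI)
    fix j assume j: "j \<le> n"
    then have *: "?t ! (b' + j) = \<sigma>' ! (b' + j) - {p} \<union> \<tau> ! (b + j) \<inter> {p}"
      using assms(3) by simp
    have "\<sigma> ! (b + j) \<inter> V = \<sigma>' ! (b' + j) \<inter> V"
      using assms(4) j by blast
    moreover have "\<forall>x. x \<noteq> p \<longrightarrow> (x \<in> \<tau> ! (b + j) \<longleftrightarrow> x \<in> \<sigma> ! (b + j))"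
      using assms(1,2) j by (simp add: agree_except_def)
    ultimately show "\<tau> ! (b + j) \<inter> V = ?t ! (b' + j) \<inter> V"
      unfolding * by blast
  qed
qed

text \<open>Stated for an abstract \<open>Q\<close> so that it serves \<open>DEx\<close> with
  \<open>sat\<close> and \<open>DAll\<close> with its negation.\<close>

lemma sat_DEx_transfer:
  assumes IH: "\<And>\<sigma> b n \<sigma>' b'. b + n < length \<sigma> \<Longrightarrow> b' + n < length \<sigma>' \<Longrightarrow>
      \<forall>j\<le>n. \<sigma> ! (b + j) \<inter> V = \<sigma>' ! (b' + j) \<inter> V \<Longrightarrow> Q \<sigma> b (b + n) \<longleftrightarrow> Q \<sigma>' b' (b' + n)"
    and "b + n < length \<sigma>" and "b' + n < length \<sigma>'"
    and "\<forall>j\<le>n. \<sigma> ! (b + j) \<inter> V = \<sigma>' ! (b' + j) \<inter> V"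
    and ex: "\<exists>\<tau>. agree_except p \<sigma> \<tau> \<and> Q \<tau> b (b + n)"
  shows "\<exists>\<tau>. agree_except p \<sigma>' \<tau> \<and> Q \<tau> b' (b' + n)"
proof -
  from ex obtain \<tau> where t: "agree_except p \<sigma> \<tau>" "Q \<tau> b (b + n)"
    by blast
  obtain \<tau>' where t': "agree_except p \<sigma>' \<tau>'" "\<forall>j\<le>n. \<tau> ! (b + j) \<inter> V = \<tau>' ! (b' + j) \<inter> V"
    using agree_except_transfer[OF t(1) assms(2-4)] by blast
  have "Q \<tau>' b' (b' + n)"
    using IH[OF _ _ t'(2)] t t'(1) assms(2,3) by (auto simp: agree_except_def)
  with t'(1) show ?thesis
    by blast
qed

lemma sat_DEx_cong:
  assumes IH: "\<And>\<sigma> b n \<sigma>' b'. b + n < length \<sigma> \<Longrightarrow> b' + n < length \<sigma>' \<Longrightarrow>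
      \<forall>j\<le>n. \<sigma> ! (b + j) \<inter> V = \<sigma>' ! (b' + j) \<inter> V \<Longrightarrow> Q \<sigma> b (b + n) \<longleftrightarrow> Q \<sigma>' b' (b' + n)"
    and "b + n < length \<sigma>" and "b' + n < length \<sigma>'"
    and "\<forall>j\<le>n. \<sigma> ! (b + j) \<inter> V = \<sigma>' ! (b' + j) \<inter> V"
  shows "(\<exists>\<tau>. agree_except p \<sigma> \<tau> \<and> Q \<tau> b (b + n)) \<longleftrightarrow>
    (\<exists>\<tau>. agree_except p \<sigma>' \<tau> \<and> Q \<tau> b' (b' + n))"
proof
  show "\<exists>\<tau>. agree_except p \<sigma> \<tau> \<and> Q \<tau> b (b + n) \<Longrightarrow>
      \<exists>\<tau>. agree_except p \<sigma>' \<tau> \<and> Q \<tau> b' (b' + n)"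
    by (rule sat_DEx_transfer[where Q = Q, OF IH assms(2-4)])
  show "\<exists>\<tau>. agree_except p \<sigma>' \<tau> \<and> Q \<tau> b' (b' + n) \<Longrightarrow>
      \<exists>\<tau>. agree_except p \<sigma> \<tau> \<and> Q \<tau> b (b + n)"
    by (rule sat_DEx_transfer[where Q = Q, OF IH assms(3,2)]) (use assms(4) in auto)
qed

text \<open>Locality is used in two ways: with \<open>V = UNIV\<close> and shifted windows it lets
  the parts of a chop be read as words of their own, and with a fixed window it allows variables
  foreign to the formula to be erased. Writing both ends as offset plus length lets one
  \<open>j\<close> index both windows.\<close>

lemma sat_cong:
  assumes "qvars D \<subseteq> V" and "b + n < length \<sigma>" and "b' + n < length \<sigma>'"
    and "\<forall>j\<le>n. \<sigma> ! (b + j) \<inter> V = \<sigma>' ! (b' + j) \<inter> V"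
  shows "sat \<sigma> b (b + n) D \<longleftrightarrow> sat \<sigma>' b' (b' + n) D"
  using assms
proof (induction D arbitrary: \<sigma> b n \<sigma>' b')
  case (Point f)
  have "pholds (\<sigma> ! b) f \<longleftrightarrow> pholds (\<sigma>' ! b') f"
    using Point pholds_cong[of "\<sigma> ! b" V "\<sigma>' ! b'" f] by (metis add_0_right le0 qvars.simps(1))
  then show ?case
    by simp
next
  case (Interval f)
  then have "\<forall>j\<le>n. pholds (\<sigma> ! (b + j)) f \<longleftrightarrow> pholds (\<sigma>' ! (b' + j)) f"
    by (metis pholds_cong qvars.simps(2))
  then show ?case
    by (auto simp: all_shift_strict)
next
  case (FullInterval f)
  then have "\<forall>j\<le>n. pholds (\<sigma> ! (b + j)) f \<longleftrightarrow> pholds (\<sigma>' ! (b' + j)) f"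
    by (metis pholds_cong qvars.simps(3))
  then show ?case
    by (auto simp: all_shift)
next
  case (Chop C D)
  have "sat \<sigma> b (b + j) C \<and> sat \<sigma> (b + j) (b + n) D \<longleftrightarrow>
      sat \<sigma>' b' (b' + j) C \<and> sat \<sigma>' (b' + j) (b' + n) D" if j: "j \<le> n" for j
  proof -
    have "sat \<sigma> b (b + j) C \<longleftrightarrow> sat \<sigma>' b' (b' + j) C"
      using Chop.prems j by (intro Chop.IH(1)) auto
    moreover have "sat \<sigma> (b + j) ((b + j) + (n - j)) D \<longleftrightarrow> sat \<sigma>' (b' + j) ((b' + j) + (n - j)) D"
      using Chop.prems j by (intro Chop.IH(2)) (auto simp: add.assoc)
    ultimately show ?thesis
      using j by simp
  qed
  then show ?case
    by (simp only: sat.simps ex_shift) blast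
next
  case (DNot D)
  show ?case
    using DNot.IH[OF _ DNot.prems(2-4)] DNot.prems(1) by simp
next
  case (DOr C D)
  show ?case
    using DOr.IH(1)[OF _ DOr.prems(2-4)] DOr.IH(2)[OF _ DOr.prems(2-4)] DOr.prems(1) by simp
next
  case (DAnd C D)
  show ?case
    using DAnd.IH(1)[OF _ DAnd.prems(2-4)] DAnd.IH(2)[OF _ DAnd.prems(2-4)] DAnd.prems(1) by simp
next
  case (DEx p D)
  show ?case
    unfolding sat.simps
    by (rule sat_DEx_cong[where Q = "\<lambda>\<tau> b e. sat \<tau> b e D", OF DEx.IH DEx.prems(2-4)])
      (use DEx.prems(1) in auto)
next
  case (DAll p D)
  have "(\<exists>\<tau>. agree_except p \<sigma> \<tau> \<and> \<not> sat \<tau> b (b + n) D) \<longleftrightarrow>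
    (\<exists>\<tau>. agree_except p \<sigma>' \<tau> \<and> \<not> sat \<tau> b' (b' + n) D)"
  proof (rule sat_DEx_cong[where Q = "\<lambda>\<tau> b e. \<not> sat \<tau> b e D", OF _ DAll.prems(2-4)])
    show "\<not> sat \<sigma> b (b + n) D \<longleftrightarrow> \<not> sat \<sigma>' b' (b' + n) D"
      if "b + n < length \<sigma>" "b' + n < length \<sigma>'"
        "\<forall>j\<le>n. \<sigma> ! (b + j) \<inter> V = \<sigma>' ! (b' + j) \<inter> V" for \<sigma> b n \<sigma>' b'
      using DAll.IH[OF _ that] DAll.prems(1) by simp
  qed
  then show ?case
    by simp
next
  case (Slen r c)
  show ?case
    by simp
next
  case (Scount f r c)
  then have "\<forall>j\<le>n. pholds (\<sigma> ! (b + j)) f \<longleftrightarrow> pholds (\<sigma>' ! (b' + j)) f"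
    by (metis pholds_cong qvars.simps(11))
  then show ?case
    by (simp add: card_shift cong: conj_cong)
next
  case (Sdur f r c)
  then have "\<forall>j<n. pholds (\<sigma> ! (b + j)) f \<longleftrightarrow> pholds (\<sigma>' ! (b' + j)) f"
    by (metis less_imp_le pholds_cong qvars.simps(12))
  then show ?case
    by (simp add: card_shift_strict cong: conj_cong)
qed

lemma models_map_Int:
  assumes "qvars D \<subseteq> V" and "\<sigma> \<noteq> []"
  shows "models (map (\<lambda>P. P \<inter> V) \<sigma>) D \<longleftrightarrow> models \<sigma> D"
proof -
  have less: "j < length \<sigma>" if "j \<le> length \<sigma> - 1" for j
    using that assms(2) by (cases \<sigma>) auto
  have "sat \<sigma> 0 (0 + (length \<sigma> - 1)) D \<longleftrightarrow> sat (map (\<lambda>P. P \<inter> V) \<sigma>) 0 (0 + (length \<sigma> - 1)) D"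
    by (rule sat_cong[OF assms(1)]) (use assms(2) less in auto)
  then show ?thesis
    by (simp add: models_def)
qed

lemma sat_take:
  assumes "i < length \<sigma>"
  shows "sat \<sigma> 0 i D \<longleftrightarrow> models (take (Suc i) \<sigma>) D"
proof -
  have "sat \<sigma> 0 (0 + i) D \<longleftrightarrow> sat (take (Suc i) \<sigma>) 0 (0 + i) D"
    by (rule sat_cong[of D UNIV]) (use assms in auto)
  moreover have "length (take (Suc i) \<sigma>) - 1 = i"
    using assms by simp
  ultimately show ?thesis
    by (simp only: models_def add_0)
qed

lemma sat_drop:
  assumes "i < length \<sigma>"
  shows "sat \<sigma> i (length \<sigma> - 1) D \<longleftrightarrow> models (drop i \<sigma>) D"
proof -
  define n where "n = length (drop i \<sigma>) - 1"
  then have len: "length \<sigma> = Suc (i + n)"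
    using assms by simp
  then have "sat \<sigma> i (i + n) D \<longleftrightarrow> sat (drop i \<sigma>) 0 (0 + n) D"
    by (intro sat_cong[of D UNIV]) auto
  moreover have "length \<sigma> - 1 = i + n"
    using len by simp
  ultimately show ?thesis
    by (simp only: models_def add_0 n_def)
qed

section \<open>QDDC languages have finitely many residuals\<close>

text \<open>On \<open>[]\<close> the predicate \<open>models\<close> looks up a letter that does not
  exist, since \<open>length [] - 1 = 0\<close>; the empty word is therefore excluded
  explicitly.\<close>

definition nonempty_models :: "'v qddc \<Rightarrow> 'v set list set" where
  "nonempty_models D = {w. w \<noteq> [] \<and> models w D}"

text \<open>A comparison with \<open>c\<close> cannot tell apart counts above \<open>c\<close>, so
  counters may be capped at \<open>Suc c\<close>.\<close>

lemma compare_add_cong: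
  assumes "min m (Suc c) = min m' (Suc c)"
  shows "compare r (m + k) c \<longleftrightarrow> compare r (m' + k) c"
  using assms by (cases r) (auto simp: min_def split: if_splits)

text \<open>Two counters, because \<open>sdur\<close> ignores the last position: \<open>N u\<close>
  is the count if the word ends with \<open>u\<close>, \<open>M u\<close> the contribution of
  \<open>u\<close> once more letters follow. The flag \<open>u = []\<close> decides whether the
  whole word can be empty.\<close>

lemma finite_residuals_counting:
  fixes N M :: "'a list \<Rightarrow> nat"
  assumes "\<And>u v. v \<noteq> [] \<Longrightarrow> N (u @ v) = M u + N v"
  shows "finite_residuals {w. w \<noteq> [] \<and> compare r (N w) c}"
proof (rule finite_residuals_invariant)
  let ?g = "\<lambda>u. (u = [], min (N u) (Suc c), min (M u) (Suc c))"
  have "range ?g \<subseteq> UNIV \<times> {..Suc c} \<times> {..Suc c}"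
    by auto
  then show "finite (range ?g)"
    by (rule finite_subset) auto
  fix u u' v
  assume g: "?g u = ?g u'" and "u @ v \<in> {w. w \<noteq> [] \<and> compare r (N w) c}"
  then have uv: "u @ v \<noteq> []" "compare r (N (u @ v)) c"
    by auto
  have "compare r (N (u' @ v)) c"
  proof (cases "v = []")
    case True
    with uv g compare_add_cong[of "N u" c "N u'" r 0] show ?thesis
      by simp
  next
    case False
    with uv g compare_add_cong[of "M u" c "M u'" r "N v"] show ?thesis
      by (simp add: assms)
  qed
  with g uv show "u' @ v \<in> {w. w \<noteq> [] \<and> compare r (N w) c}"
    by auto
qed

lemma finite_residuals_Scount: "finite_residuals (nonempty_models (Scount f r c))"
proof -
  have card: "card {i. i \<le> length w - 1 \<and> pholds (w ! i) f} = length (filter (\<lambda>P. pholds P f) w)"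
    if "w \<noteq> []" for w
  proof -
    have "i \<le> length w - 1 \<longleftrightarrow> i < length w" for i
      using that by (cases w) auto
    then show ?thesis
      by (simp add: length_filter_conv_card)
  qed
  have "nonempty_models (Scount f r c) =
      {w. w \<noteq> [] \<and> compare r (length (filter (\<lambda>P. pholds P f) w)) c}"
    using card by (auto simp: nonempty_models_def models_def)
  also have "finite_residuals \<dots>"
    by (rule finite_residuals_counting[where M = "\<lambda>w. length (filter (\<lambda>P. pholds P f) w)"]) simp
  finally show ?thesis .
qed

lemma finite_residuals_Sdur: "finite_residuals (nonempty_models (Sdur f r c))"
proof -
  have card: "card {i. i < length w - 1 \<and> pholds (w ! i) f} =
      length (filter (\<lambda>P. pholds P f) (butlast w))" for w
    by (auto simp: length_filter_conv_card nth_butlast intro!: arg_cong[where f = card])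
  have "nonempty_models (Sdur f r c) =
      {w. w \<noteq> [] \<and> compare r (length (filter (\<lambda>P. pholds P f) (butlast w))) c}"
    using card by (auto simp: nonempty_models_def models_def)
  also have "finite_residuals \<dots>"
    by (rule finite_residuals_counting[where M = "\<lambda>w. length (filter (\<lambda>P. pholds P f) w)"])
      (simp add: butlast_append)
  finally show ?thesis .
qed

lemma agree_except_append:
  "agree_except p (u @ v) w \<longleftrightarrow> (\<exists>u' v'. w = u' @ v' \<and> agree_except p u u' \<and> agree_except p v v')"
proof -
  have *: "agree_except p x y \<longleftrightarrow> list_all2 (\<lambda>P Q. P - {p} = Q - {p}) x y" for x y
    unfolding agree_except_def list_all2_conv_all_nth by auto
  show ?thesis
    unfolding * list_all2_append1 by (metis list_all2_lengthD)
qed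

text \<open>Complementation would readmit the empty word, hence the second factor.\<close>

lemma nonempty_models_DNot: "nonempty_models (DNot D) = - nonempty_models D \<inter> - {[]}"
  by (auto simp: nonempty_models_def models_def)

lemma nonempty_models_Chop:
  "nonempty_models (Chop C D) = fusion (nonempty_models C) (nonempty_models D)"
  for C D :: "'a qddc"
proof (rule set_eqI)
  fix w :: "'a set list"
  have *: "i \<le> length w - 1 \<longleftrightarrow> i < length w" if "w \<noteq> []" for i
    using that by (cases w) auto
  show "w \<in> nonempty_models (Chop C D) \<longleftrightarrow> w \<in> fusion (nonempty_models C) (nonempty_models D)"
  proof (cases "w = []")
    case False
    then have "w \<in> nonempty_models (Chop C D) \<longleftrightarrow>
        (\<exists>i<length w. sat w 0 i C \<and> sat w i (length w - 1) D)"
      by (simp add: nonempty_models_def models_def * del: One_nat_def)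
    also have "\<dots> \<longleftrightarrow> w \<in> fusion (nonempty_models C) (nonempty_models D)"
      using False by (auto simp: fusion_def nonempty_models_def sat_take sat_drop simp del: One_nat_def)
    finally show ?thesis .
  qed (simp add: nonempty_models_def fusion_def)
qed

lemma nonempty_models_DEx:
  "nonempty_models (DEx p D) = {w. \<exists>w'. agree_except p w w' \<and> w' \<in> nonempty_models D}"
  by (auto simp: nonempty_models_def models_def agree_except_def)

lemma finite_residuals_DNot:
  "finite_residuals (nonempty_models D) \<Longrightarrow> finite_residuals (nonempty_models (DNot D))"
  unfolding nonempty_models_DNot
  by (intro finite_residuals_Int finite_residuals_Compl finite_residuals_Nil)

lemma finite_residuals_DEx:
  "finite_residuals (nonempty_models D) \<Longrightarrow> finite_residuals (nonempty_models (DEx p D))"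
  unfolding nonempty_models_DEx
  by (rule finite_residuals_relational_image[where R = "agree_except p", OF agree_except_append])

lemma finite_residuals_FullInterval: "finite_residuals (nonempty_models (FullInterval f))"
proof -
  have "nonempty_models (FullInterval f) = nonempty_models (Scount (PNot f) CEq 0)"
    by (auto simp: nonempty_models_def models_def)
  then show ?thesis
    by (simp only: finite_residuals_Scount)
qed

lemma finite_residuals_Slen: "finite_residuals (nonempty_models (Slen r c :: 'v qddc))"
proof -
  have "nonempty_models (Slen r c :: 'v qddc) = nonempty_models (Sdur PTrue r c)"
    by (auto simp: nonempty_models_def models_def)
  then show ?thesis
    by (simp only: finite_residuals_Sdur)
qed

text \<open>Every atom reduces to counting, for instance \<open>[[f]]\<close> to the absence of
  positions violating \<open>f\<close>, and every connective has its closure property.\<close>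

lemma finite_residuals_nonempty_models: "finite_residuals (nonempty_models D)"
proof (induction D)
  case (Point f)
  have "nonempty_models (Point f) = nonempty_models (Slen CEq 0) \<inter> nonempty_models (FullInterval f)"
    by (auto simp: nonempty_models_def models_def)
  then show ?case
    by (simp only: finite_residuals_Int finite_residuals_Slen finite_residuals_FullInterval)
next
  case (Interval f)
  have "nonempty_models (Interval f) =
      nonempty_models (Slen CGreater 0) \<inter> nonempty_models (Sdur (PNot f) CEq 0)"
    by (auto simp: nonempty_models_def models_def)
  then show ?case
    by (simp only: finite_residuals_Int finite_residuals_Slen finite_residuals_Sdur)
next
  case (Chop C D)
  then show ?case
    unfolding nonempty_models_Chop by (rule finite_residuals_fusion)
next
  case (DOr C D)
  have "nonempty_models (DOr C D) = nonempty_models C \<union> nonempty_models D"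
    by (auto simp: nonempty_models_def models_def)
  with DOr show ?case
    by (simp only: finite_residuals_Un)
next
  case (DAnd C D)
  have "nonempty_models (DAnd C D) = nonempty_models C \<inter> nonempty_models D"
    by (auto simp: nonempty_models_def models_def)
  with DAnd show ?case
    by (simp only: finite_residuals_Int)
next
  case (DAll p D)
  have "nonempty_models (DAll p D) = nonempty_models (DNot (DEx p (DNot D)))"
    by (auto simp: nonempty_models_def models_def)
  with DAll show ?case
    by (simp only: finite_residuals_DNot finite_residuals_DEx)
qed (simp_all only: finite_residuals_FullInterval finite_residuals_DNot finite_residuals_DEx
    finite_residuals_Slen finite_residuals_Scount finite_residuals_Sdur)

section \<open>The safety game on residuals\<close>

text \<open>A greatest fixed point, because safety has to be maintained forever. A position is the
  residual of the word played so far, so \<open>[] \<in> K\<close> says that this word is still in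
  the objective; the environment chooses \<open>i\<close> and the controller answers with
  \<open>o'\<close>.\<close>

coinductive winning :: "'v set \<Rightarrow> 'v set \<Rightarrow> 'v set list set \<Rightarrow> bool" for Inp Out where
  "[] \<in> K \<Longrightarrow> (\<forall>i. i \<subseteq> Inp \<longrightarrow> (\<exists>o'. o' \<subseteq> Out \<and> winning Inp Out (residual K [i \<union> o'])))
    \<Longrightarrow> winning Inp Out K"

lemma not_winning_empty [simp]: "\<not> winning Inp Out {}"
  by (auto elim: winning.cases)

lemma residual_empty [simp]: "residual {} u = {}"
  by auto

lemma residual_residual: "residual (residual L u) v = residual L (u @ v)"
  by auto

lemma run_Nil: "run Inp Out M [] = init M"
  by (simp add: run_def)

lemma run_snoc:
  "run Inp Out M (\<sigma> @ [P]) = trans M (run Inp Out M \<sigma>) (P \<inter> Inp) (P \<inter> Out)"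
  by (simp add: run_def)

lemma mealy_run_in_states:
  assumes "mealy_machine Inp Out M"
  shows "run Inp Out M \<sigma> \<in> states M"
proof (induction \<sigma> rule: rev_induct)
  case Nil
  show ?case
    using assms by (auto simp: run_Nil mealy_machine_def)
next
  case (snoc P \<sigma>)
  then show ?case
    using assms by (auto simp: run_snoc mealy_machine_def)
qed

text \<open>The only non-final state is a sink, so a run that has left \<open>final M\<close> never
  returns.\<close>

lemma mealy_run_final_butlast:
  assumes M: "mealy_machine Inp Out M" and "run Inp Out M (\<sigma> @ [P]) \<in> final M"
  shows "run Inp Out M \<sigma> \<in> final M"
proof (rule ccontr)
  obtain r where r: "final M = states M - {r}" "\<forall>i\<subseteq>Inp. \<forall>o'\<subseteq>Out. trans M r i o' = r"
    using M by (auto simp: mealy_machine_def)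
  assume "run Inp Out M \<sigma> \<notin> final M"
  with r mealy_run_in_states[OF M] have "run Inp Out M \<sigma> = r"
    by blast
  with r have "run Inp Out M (\<sigma> @ [P]) = r"
    by (simp add: run_snoc)
  with assms(2) r show False
    by simp
qed

lemma supervisor_run_winning:
  assumes S: "supervisor Inp Out S" and disj: "Inp \<inter> Out = {}"
    and lang: "sup_lang Inp Out S \<subseteq> L" and Nil: "[] \<in> L"
    and "\<forall>P\<in>set w. P \<subseteq> Inp \<union> Out" and "run Inp Out S w \<in> final S"
  shows "winning Inp Out (residual L w)"
proof -
  \<comment> \<open>The coinduction invariant: residuals of words along which \<open>S\<close> stays
    final. The non-blocking condition of \<open>S\<close> supplies the answers of the
    controller.\<close>
  define X where "X K \<longleftrightarrow>
      (\<exists>w. K = residual L w \<and> (\<forall>P\<in>set w. P \<subseteq> Inp \<union> Out) \<and> run Inp Out S w \<in> final S)" for K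
  have "X (residual L w)"
    using assms(5,6) unfolding X_def by blast
  then show ?thesis
  proof (rule winning.coinduct)
    fix K assume "X K"
    then obtain w where w: "K = residual L w" "\<forall>P\<in>set w. P \<subseteq> Inp \<union> Out"
        "run Inp Out S w \<in> final S"
      unfolding X_def by blast
    have "w \<in> L"
      using w(2,3) lang Nil by (cases "w = []") (auto simp: sup_lang_def words_def)
    then have "[] \<in> K"
      using w(1) by simp
    moreover have "\<exists>o'\<subseteq>Out. X (residual K [i \<union> o']) \<or> winning Inp Out (residual K [i \<union> o'])"
      if i: "i \<subseteq> Inp" for i
    proof -
      obtain o' where o': "o' \<subseteq> Out" "trans S (run Inp Out S w) i o' \<in> final S"
        using S w(3) i unfolding supervisor_def non_blocking_def by blast
      have "(i \<union> o') \<inter> Inp = i" "(i \<union> o') \<inter> Out = o'"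
        using i o'(1) disj by auto
      then have "run Inp Out S (w @ [i \<union> o']) \<in> final S"
        using o'(2) by (simp add: run_snoc)
      moreover have "\<forall>P\<in>set (w @ [i \<union> o']). P \<subseteq> Inp \<union> Out"
        using w(2) i o'(1) by auto
      ultimately have "X (residual K [i \<union> o'])"
        unfolding w(1) residual_residual X_def by blast
      with o'(1) show ?thesis
        by blast
    qed
    ultimately show "\<exists>K'. K = K' \<and> [] \<in> K' \<and>
        (\<forall>i\<subseteq>Inp. \<exists>o'\<subseteq>Out. X (residual K' [i \<union> o']) \<or> winning Inp Out (residual K' [i \<union> o']))"
      by simp
  qed
qed

text \<open>The empty language serves as the sink: it is never winning.\<close>

definition game_supervisor ::
  "'v set \<Rightarrow> 'v set \<Rightarrow> 'v set list set \<Rightarrow> ('v set list set, 'v) mealy" where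
  "game_supervisor Inp Out L =
     \<lparr>states = insert {} {K \<in> range (residual L). winning Inp Out K},
      init = L,
      trans = (\<lambda>K i o'. if winning Inp Out (residual K [i \<union> o']) then residual K [i \<union> o'] else {}),
      final = {K \<in> range (residual L). winning Inp Out K}\<rparr>"

text \<open>The state set is finite because there are finitely many residuals, and non-blocking is
  one unfolding of \<open>winning\<close>.\<close>

lemma supervisor_game_supervisor:
  assumes "finite_residuals L" and "winning Inp Out L"
  shows "supervisor Inp Out (game_supervisor Inp Out L)"
proof -
  let ?M = "game_supervisor Inp Out L"
  have closed: "residual K u \<in> range (residual L)" if "K \<in> range (residual L)" for K u
    using that by (auto simp: residual_residual)
  have "L = residual L []"
    by auto
  then have L: "L \<in> range (residual L)"
    by (rule range_eqI)
  have "mealy_machine Inp Out ?M"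
    unfolding mealy_machine_def
  proof (intro conjI bexI[of _ "{}"] ballI allI impI)
    show "finite (states ?M)"
      using assms(1) by (simp add: game_supervisor_def finite_residuals_def)
    show "trans ?M q i o' \<in> states ?M" if "q \<in> states ?M" for q i o'
      using that closed by (auto simp: game_supervisor_def)
    show "final ?M = states ?M - {{}}" "{} \<in> states ?M" and "trans ?M {} i o' = {}" for i o'
      by (auto simp: game_supervisor_def)
    show "init ?M \<in> final ?M"
      using assms(2) L by (simp add: game_supervisor_def)
  qed
  moreover have "non_blocking Inp Out ?M"
    unfolding non_blocking_def
  proof (intro ballI allI impI)
    fix K i assume K: "K \<in> final ?M" and i: "i \<subseteq> Inp"
    then have "winning Inp Out K"
      by (simp add: game_supervisor_def)
    then have "\<exists>o'\<subseteq>Out. winning Inp Out (residual K [i \<union> o'])"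
      by cases (use i in auto)
    with K closed show "\<exists>o'\<subseteq>Out. trans ?M K i o' \<in> final ?M"
      by (auto simp: game_supervisor_def)
  qed
  ultimately show ?thesis
    by (simp add: supervisor_def)
qed

lemma game_supervisor_step:
  assumes "P \<subseteq> Inp \<union> Out"
  shows "trans (game_supervisor Inp Out L) K (P \<inter> Inp) (P \<inter> Out) =
    (if winning Inp Out (residual K [P]) then residual K [P] else {})"
proof -
  have "P \<inter> Inp \<union> P \<inter> Out = P"
    using assms by blast
  then show ?thesis
    by (simp add: game_supervisor_def)
qed

text \<open>The sink is absorbing since residuals of \<open>{}\<close> are \<open>{}\<close>. As
  \<open>{}\<close> is not winning, a run ending in a final state must have ended in the true
  residual.\<close>

lemma run_game_supervisor:
  assumes "\<forall>P\<in>set w. P \<subseteq> Inp \<union> Out"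
  shows "run Inp Out (game_supervisor Inp Out L) w \<in> {residual L w, {}}"
  using assms
proof (induction w rule: rev_induct)
  case Nil
  show ?case
    by (auto simp: run_Nil game_supervisor_def)
next
  case (snoc P w)
  then show ?case
    by (auto simp: run_snoc game_supervisor_step residual_residual)
qed

lemma sup_lang_game_supervisor:
  "sup_lang Inp Out (game_supervisor Inp Out L) \<subseteq> L"
proof
  fix w assume w: "w \<in> sup_lang Inp Out (game_supervisor Inp Out L)"
  let ?q = "run Inp Out (game_supervisor Inp Out L) w"
  have win: "winning Inp Out ?q"
    using w by (auto simp: sup_lang_def game_supervisor_def)
  moreover have "?q \<in> {residual L w, {}}"
    using w by (intro run_game_supervisor) (auto simp: sup_lang_def words_def)
  ultimately have "winning Inp Out (residual L w)"
    by auto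
  then show "w \<in> L"
    by (auto elim: winning.cases)
qed

text \<open>All prefixes of a word accepted by \<open>S\<close> keep \<open>S\<close> final, so
  their residuals are winning and the game machine is never sent to its sink.\<close>

lemma game_supervisor_permissive:
  assumes S: "supervisor Inp Out S" and disj: "Inp \<inter> Out = {}"
    and lang: "sup_lang Inp Out S \<subseteq> L" and Nil: "[] \<in> L"
  shows "sup_lang Inp Out S \<subseteq> sup_lang Inp Out (game_supervisor Inp Out L)"
proof
  have M: "mealy_machine Inp Out S"
    using S by (simp add: supervisor_def)
  have run: "run Inp Out (game_supervisor Inp Out L) w = residual L w"
    if "\<forall>P\<in>set w. P \<subseteq> Inp \<union> Out" "run Inp Out S w \<in> final S" for w
    using that
  proof (induction w rule: rev_induct)
    case Nil
    show ?case
      by (auto simp: run_Nil game_supervisor_def)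
  next
    case (snoc P w)
    have "run Inp Out (game_supervisor Inp Out L) w = residual L w"
      using snoc mealy_run_final_butlast[OF M snoc.prems(2)] by simp
    moreover have "winning Inp Out (residual L (w @ [P]))"
      by (rule supervisor_run_winning[OF assms snoc.prems])
    ultimately show ?case
      using snoc.prems(1) by (simp add: run_snoc game_supervisor_step residual_residual)
  qed
  fix w assume "w \<in> sup_lang Inp Out S"
  then have w: "w \<in> words (Inp \<union> Out)" "\<forall>P\<in>set w. P \<subseteq> Inp \<union> Out" "run Inp Out S w \<in> final S"
    by (auto simp: sup_lang_def words_def)
  have "winning Inp Out (residual L w)"
    by (rule supervisor_run_winning[OF assms w(2,3)])
  with w run[OF w(2,3)] show "w \<in> sup_lang Inp Out (game_supervisor Inp Out L)"
    by (simp add: sup_lang_def game_supervisor_def)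
qed

section \<open>Existence of maximally permissive supervisors\<close>

text \<open>Bridges a gap of types: the states of the game machine are languages, while
  \<open>is_MPS\<close> ranges over machines with natural numbers as states.\<close>

lemma supervisor_nat_states:
  fixes M :: "('q, 'v) mealy"
  assumes "supervisor Inp Out M"
  obtains N :: "(nat, 'v) mealy"
  where "supervisor Inp Out N" and "sup_lang Inp Out N = sup_lang Inp Out M"
proof -
  have M: "mealy_machine Inp Out M" and nb: "non_blocking Inp Out M"
    using assms by (auto simp: supervisor_def)
  have "finite (states M)"
    using M by (simp add: mealy_machine_def)
  then obtain h :: "'q \<Rightarrow> nat" where inj: "inj_on h (states M)"
    using finite_imp_inj_to_nat_seg by metis
  define g where "g = inv_into (states M) h"
  have gh [simp]: "g (h q) = q" if "q \<in> states M" for q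
    using inj that by (simp add: g_def)
  obtain r where r: "r \<in> states M" "final M = states M - {r}"
      "\<forall>i\<subseteq>Inp. \<forall>o'\<subseteq>Out. trans M r i o' = r"
    using M by (auto simp: mealy_machine_def)
  have init: "init M \<in> final M"
    and closed: "\<forall>q\<in>states M. \<forall>i\<subseteq>Inp. \<forall>o'\<subseteq>Out. trans M q i o' \<in> states M"
    using M by (simp_all add: mealy_machine_def)
  define N where "N = \<lparr>states = h ` states M, init = h (init M),
      trans = (\<lambda>k i o'. h (trans M (g k) i o')), final = h ` final M\<rparr>"
  have fin: "h q \<in> h ` final M \<longleftrightarrow> q \<in> final M" if "q \<in> states M" for q
    by (rule inj_on_image_mem_iff[OF inj that]) (simp add: r(2))
  have "h ` final M = h ` states M - {h r}"
    using inj_on_image_set_diff[OF inj, of "states M" "{r}"] r(1,2) by simp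
  then have "mealy_machine Inp Out N"
    using \<open>finite (states M)\<close> r init closed by (auto simp: mealy_machine_def N_def)
  moreover have "non_blocking Inp Out N"
    unfolding non_blocking_def
  proof (intro ballI allI impI)
    fix k i assume "k \<in> final N" and i: "i \<subseteq> Inp"
    then obtain q where q: "k = h q" "q \<in> final M"
      by (auto simp: N_def)
    have "\<exists>o'\<subseteq>Out. trans M q i o' \<in> final M"
      using nb q(2) i by (simp add: non_blocking_def)
    then obtain o' where o': "o' \<subseteq> Out" "trans M q i o' \<in> final M"
      by blast
    have "g k = q"
      using q r(2) by simp
    with o' have "trans N k i o' \<in> final N"
      by (simp add: N_def)
    with o'(1) show "\<exists>o'\<subseteq>Out. trans N k i o' \<in> final N"
      by blast
  qed
  moreover have run: "run Inp Out N w = h (run Inp Out M w)" for w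
  proof (induction w rule: rev_induct)
    case Nil
    show ?case
      by (simp add: run_Nil N_def)
  next
    case (snoc P w)
    then show ?case
      using mealy_run_in_states[OF M, of w] by (simp add: run_snoc N_def)
  qed
  have "sup_lang Inp Out N = sup_lang Inp Out M"
    using fin[OF mealy_run_in_states[OF M]] unfolding sup_lang_def run by (simp add: N_def)
  ultimately show ?thesis
    using that by (simp add: supervisor_def)
qed

text \<open>Supervisor languages contain only non-empty words, so adding \<open>[]\<close> to the
  objective changes nothing here, yet it makes the initial position of the game safe.\<close>

lemma realizes_inv_iff:
  "realizes_inv Inp Out D S \<longleftrightarrow> sup_lang Inp Out S \<subseteq> {[]} \<union> nonempty_models D"
  by (auto simp: nonempty_models_def realizes_inv_def lang_def sup_lang_def words_def)

lemma is_MPS_exists: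
  fixes S :: "(nat, 'v) mealy"
  assumes disj: "Inp \<inter> Out = {}" and S: "supervisor Inp Out S" and real: "realizes_inv Inp Out D S"
  shows "\<exists>S'. is_MPS Inp Out D S'"
proof -
  define L where "L = {[]} \<union> nonempty_models D"
  note lang = realizes_inv_iff[of Inp Out D, folded L_def]
  have Nil: "[] \<in> L"
    by (simp add: L_def)
  have "finite_residuals L"
    unfolding L_def
    by (intro finite_residuals_Un finite_residuals_Nil finite_residuals_nonempty_models)
  moreover have "winning Inp Out L"
  proof -
    have "run Inp Out S [] \<in> final S"
      using S by (auto simp: supervisor_def mealy_machine_def run_Nil)
    then have "winning Inp Out (residual L [])"
      using supervisor_run_winning[OF S disj _ Nil, of "[]"] real by (simp add: lang)
    then show ?thesis
      by (simp add: residual_def)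
  qed
  ultimately have "supervisor Inp Out (game_supervisor Inp Out L)"
    by (rule supervisor_game_supervisor)
  then obtain N :: "(nat, 'v) mealy" where N: "supervisor Inp Out N"
      "sup_lang Inp Out N = sup_lang Inp Out (game_supervisor Inp Out L)"
    by (rule supervisor_nat_states)
  have "realizes_inv Inp Out D N"
    using sup_lang_game_supervisor by (simp add: lang N(2))
  moreover have "det_le Inp Out N S'"
    if "supervisor Inp Out S'" "realizes_inv Inp Out D S'" for S' :: "(nat, 'v) mealy"
    using game_supervisor_permissive[OF that(1) disj _ Nil] that(2)
    by (simp add: det_le_def lang N(2))
  ultimately have "maximally_permissive Inp Out D N"
    using N(1) by (simp add: maximally_permissive_def)
  then show ?thesis
    \<comment> \<open>State counts are natural numbers, so one maximally permissive machine yields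
      one with the fewest states.\<close>
    unfolding is_MPS_def
    using ex_has_least_nat[of "maximally_permissive Inp Out D" N "\<lambda>S. card (states S)"] by blast
qed

section \<open>Comparing robustness criteria\<close>

text \<open>Validity speaks only of words over \<open>V\<close>, whereas \<open>\<sigma>\<close> may
  use further variables; intersecting each letter with \<open>V\<close> leaves the truth of
  \<open>C\<close> and \<open>D\<close> unchanged.\<close>

lemma valid_DImp_models:
  assumes "valid V (DImp C D)" and "qvars C \<subseteq> V" and "qvars D \<subseteq> V"
    and "\<sigma> \<noteq> []" and "models \<sigma> C"
  shows "models \<sigma> D"
proof -
  let ?\<tau> = "map (\<lambda>P. P \<inter> V) \<sigma>"
  have "?\<tau> \<in> words V"
    using assms(4) by (auto simp: words_def)
  then have "models ?\<tau> (DImp C D)"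
    using assms(1) by (auto simp: valid_def lang_def)
  then have "models ?\<tau> C \<longrightarrow> models ?\<tau> D"
    by (simp add: models_def DImp_def)
  with assms show ?thesis
    by (simp add: models_map_Int)
qed

text \<open>The criterion occurs in the premise of an implication, so weakening it strengthens the
  formula.\<close>

lemma lang_robust_formula_antimono:
  assumes "valid V (DImp Rb1 Rb2)" and "qvars Rb1 \<subseteq> V" and "qvars Rb2 \<subseteq> V"
  shows "lang PV (robust_formula A DA DC Rb2) \<subseteq> lang PV (robust_formula A DA DC Rb1)"
proof
  fix \<sigma> assume s: "\<sigma> \<in> lang PV (robust_formula A DA DC Rb2)"
  then have "models \<sigma> Rb1 \<longrightarrow> models \<sigma> Rb2"
    using valid_DImp_models[OF assms] by (simp add: lang_def words_def)
  with s show "\<sigma> \<in> lang PV (robust_formula A DA DC Rb1)"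
    by (auto simp: lang_def models_def robust_formula_def DImp_def)
qed

text \<open>A larger language leaves more output words to check for each input word, hence fewer
  inputs that guarantee \<open>D\<close>.\<close>

lemma det_le_imp_must_le: "det_le Inp Out S1 S2 \<Longrightarrow> must_le Inp Out D S1 S2"
  unfolding det_le_def must_le_def MustInp_def by blast

theorem theorem2:
  fixes Inp Out :: "'v set" and A :: 'v and Rb1 Rb2 DA DC :: "'v qddc"
  assumes "finite Inp" and "finite Out" and "Inp \<inter> Out = {}"
    and "A \<notin> Inp \<union> Out"
    and "qvars Rb1 \<subseteq> {A}" and "qvars Rb2 \<subseteq> {A}"
    and "valid {A} (DImp Rb1 Rb2)"
    and "qvars DA \<subseteq> Inp \<union> Out" and "qvars DC \<subseteq> Inp \<union> Out"
  shows "(\<forall>S1 S2. is_robust_MPS Inp Out A DA DC Rb1 S1 \<and> is_robust_MPS Inp Out A DA DC Rb2 S2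
            \<longrightarrow> must_le Inp (insert A Out) DC S1 S2)
       \<and> (robust_realizable Inp Out A DA DC Rb2 \<longrightarrow> robust_realizable Inp Out A DA DC Rb1)"
proof -
  let ?Out = "insert A Out"
  let ?phi1 = "robust_formula A DA DC Rb1"
  have Rb2: "supervisor Inp ?Out S \<and> realizes_inv Inp ?Out ?phi1 S"
    if "is_robust_MPS Inp Out A DA DC Rb2 S" for S
    using that lang_robust_formula_antimono[OF assms(7,5,6)]
    unfolding is_robust_MPS_def is_MPS_def maximally_permissive_def realizes_inv_def by blast
  have "must_le Inp ?Out DC S1 S2"
    if "is_robust_MPS Inp Out A DA DC Rb1 S1" "is_robust_MPS Inp Out A DA DC Rb2 S2" for S1 S2
  proof (rule det_le_imp_must_le)
    show "det_le Inp ?Out S1 S2"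
      using that(1) Rb2[OF that(2)]
      unfolding is_robust_MPS_def is_MPS_def maximally_permissive_def by blast
  qed
  moreover have "robust_realizable Inp Out A DA DC Rb1"
    if real: "robust_realizable Inp Out A DA DC Rb2"
  proof -
    obtain S where "is_robust_MPS Inp Out A DA DC Rb2 S"
      using real by (auto simp: robust_realizable_def)
    \<comment> \<open>Freshness of \<open>A\<close> keeps inputs and extended outputs disjoint, so
      letters split uniquely into moves of the game.\<close>
    moreover have "Inp \<inter> ?Out = {}"
      using assms(3,4) by blast
    ultimately show ?thesis
      using is_MPS_exists Rb2 unfolding robust_realizable_def is_robust_MPS_def by blast
  qed
  ultimately show ?thesis
    by blast
qed

end
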